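(* The function $f:\mathbb{R}\to[0,1]$, $f(x)=\prod_{n=0}^{\infty}[\sin(2^n x)]^{2/(2n+1)^2}$, is Lebesgue integrable on the interval $[0,\pi]$ but is not Riemann integrable on $[0,\pi]$.
   Context: For real $y$ and integer $n\ge 0$, the exponent $2/(2n+1)^2$ is a positive rational number with even numerator and odd denominator, and the power is interpreted as $[\sin y]^{2/(2n+1)^2}=|\sin y|^{2/(2n+1)^2}\in[0,1]$. The infinite product is by definition the limit of the partial products $\prod_{n=0}^{k}[\sin(2^n x)]^{2/(2n+1)^2}$ as $k\to\infty$, which form a non-increasing sequence in $[0,1]$; if this limit is $0$, then $f(x)=0$. *)

theory Defs
  imports "HOL-Analysis.Analysis"
begin

text \<open>
  The exponent has even numerator and odd denominator, so the power of the possibly negative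
  number \<open>sin (2 ^ n * x)\<close> is the power of its absolute value; \<open>0 powr a = 0\<close> covers the zeros
  of the sine.
\<close>

definition sin_partial_prod :: "real \<Rightarrow> nat \<Rightarrow> real" where
  "sin_partial_prod x k = (\<Prod>n\<le>k. \<bar>sin (2 ^ n * x)\<bar> powr (2 / (2 * real n + 1)\<^sup>2))"

text \<open>
  \<open>prodinf\<close> is not suitable here: it does not assign the value 0 to products whose
  partial products tend to 0 without a vanishing factor.
\<close>

definition sin_prod :: "real \<Rightarrow> real" where
  "sin_prod x = lim (sin_partial_prod x)"

text \<open>
  Riemann integrability on \<open>{a..b}\<close> in the classical sense: Riemann sums converge as the mesh of
  the tagged partition tends to 0. In contrast to the gauge integral \<open>integrable_on\<close>, \<open>\<delta>\<close> is
  a constant.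
\<close>

definition riemann_integrable :: "(real \<Rightarrow> real) \<Rightarrow> real \<Rightarrow> real \<Rightarrow> bool" where
  "riemann_integrable f a b \<longleftrightarrow>
     (\<exists>I. \<forall>\<epsilon>>0. \<exists>\<delta>>0. \<forall>p. p tagged_division_of {a..b} \<and> (\<forall>(t, K)\<in>p. measure lborel K < \<delta>) \<longrightarrow>
        \<bar>(\<Sum>(t, K)\<in>p. measure lborel K * f t) - I\<bar> < \<epsilon>)"

lemma sin_partial_prod_bounds: "0 \<le> sin_partial_prod x k" "sin_partial_prod x k \<le> 1"
  unfolding sin_partial_prod_def by (auto intro!: prod_nonneg prod_le_1 powr_le1)

lemma decseq_sin_partial_prod: "decseq (sin_partial_prod x)"
proof (rule decseq_SucI)
  fix k
  have "sin_partial_prod x (Suc k) =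
      sin_partial_prod x k * \<bar>sin (2 ^ Suc k * x)\<bar> powr (2 / (2 * real (Suc k) + 1)\<^sup>2)"
    unfolding sin_partial_prod_def by (rule prod.atMost_Suc)
  also have "\<dots> \<le> sin_partial_prod x k"
    by (rule mult_left_le) (auto intro!: powr_le1 sin_partial_prod_bounds)
  finally show "sin_partial_prod x (Suc k) \<le> sin_partial_prod x k" .
qed

lemma sin_partial_prod_LIMSEQ: "sin_partial_prod x \<longlonglongrightarrow> sin_prod x"
proof -
  obtain L where "sin_partial_prod x \<longlonglongrightarrow> L"
    using decseq_convergent[OF decseq_sin_partial_prod] sin_partial_prod_bounds(1) by metis
  then show ?thesis
    by (simp add: sin_prod_def limI)
qed

end

theory Submission
  imports Defs "HOL-Real_Asymp.Real_Asymp"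
begin

text \<open>
  Every dyadic multiple of \<open>\<pi>\<close> makes some factor of the product vanish, and these points are dense,
  so there are Riemann sums of arbitrarily small mesh that equal 0. If the function were Riemann
  integrable, its integral would therefore be 0.

  On the other hand, put \<open>\<epsilon>\<^sub>n = 1 / (4 (n + 1) (n + 2))\<close>. The set of \<open>x \<in> {0..\<pi>}\<close> with
  \<open>\<bar>sin (2\<^sup>n x)\<bar> < \<epsilon>\<^sub>n\<close> has measure at most \<open>2 \<pi> \<epsilon>\<^sub>n\<close>, and \<open>\<Sum>\<epsilon>\<^sub>n = 1 / 4\<close>; outside a set of measure
  at most \<open>\<pi> / 2\<close> all factors are thus at least \<open>\<epsilon>\<^sub>n\<close> to the power \<open>2 / (2 n + 1)\<^sup>2\<close>. The
  product of these lower bounds is positive because \<open>ln (1 / \<epsilon>\<^sub>n)\<close> grows only logarithmically, so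
  the integral is positive.
\<close>

section \<open>Riemann integrability\<close>

text \<open>A constant mesh bound is a special gauge: if each cell lies in a ball of radius
  \<open>\<delta> / 2\<close> about its tag, its length is below \<open>\<delta>\<close>. This makes
  the monotonicity of the gauge integral available for \<open>I\<close>.\<close>

lemma riemann_integrable_imp_has_integral:
  assumes "\<And>\<epsilon>. \<epsilon> > 0 \<Longrightarrow> \<exists>\<delta>>0. \<forall>p. p tagged_division_of {a..b} \<and>
      (\<forall>(t, K)\<in>p. measure lborel K < \<delta>) \<longrightarrow>
      \<bar>(\<Sum>(t, K)\<in>p. measure lborel K * f t) - I\<bar> < \<epsilon>"
  shows "(f has_integral I) {a..b::real}"
  unfolding has_integral_real
proof (intro allI impI)
  fix e :: real
  assume "e > 0"
  then obtain \<delta> where "\<delta> > 0" and \<delta>: "\<And>p. p tagged_division_of {a..b} \<Longrightarrow>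
      (\<forall>(t, K)\<in>p. measure lborel K < \<delta>) \<Longrightarrow>
      \<bar>(\<Sum>(t, K)\<in>p. measure lborel K * f t) - I\<bar> < e"
    using assms by meson
  define \<gamma> :: "real \<Rightarrow> real set" where "\<gamma> x = ball x (\<delta> / 2)" for x
  have "gauge \<gamma>"
    using \<open>\<delta> > 0\<close> by (simp add: gauge_def \<gamma>_def)
  moreover have "norm ((\<Sum>(x, K)\<in>p. measure lborel K *\<^sub>R f x) - I) < e"
    if p: "p tagged_division_of {a..b}" and fine: "\<gamma> fine p" for p
  proof -
    have "measure lborel K < \<delta>" if tK: "(t, K) \<in> p" for t K
    proof -
      obtain u v where K: "K = {u..v}"
        using tagged_division_ofD(4)[OF p tK] by auto
      have "t \<in> K" "K \<subseteq> ball t (\<delta> / 2)"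
        using tagged_division_ofD(2)[OF p tK] fineD[OF fine tK] by (auto simp: \<gamma>_def)
      \<comment> \<open>The tag makes \<open>K\<close> nonempty, so both endpoints belong to
        \<open>K\<close> and hence to the ball.\<close>
      moreover from this K have "u \<le> v" "u \<in> K" "v \<in> K"
        by auto
      ultimately have "dist t u < \<delta> / 2" "dist t v < \<delta> / 2"
        by (meson mem_ball subsetD)+
      then show ?thesis
        using K \<open>u \<le> v\<close> dist_triangle_half_r[of t u \<delta> v] by (simp add: dist_real_def)
    qed
    then show ?thesis
      using \<delta>[OF p] by auto
  qed
  ultimately show "\<exists>\<gamma>. gauge \<gamma> \<and> (\<forall>p. p tagged_division_of {a..b} \<and> \<gamma> fine p \<longrightarrow>
      norm ((\<Sum>(x, K)\<in>p. measure lborel K *\<^sub>R f x) - I) < e)"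
    by (intro exI[of _ \<gamma>]) simp
qed

text \<open>Cells are tagged at their left endpoints, so that for \<open>a = 0\<close> and
  \<open>h = pi / 2 ^ m\<close> all tags are dyadic multiples of \<open>pi\<close>. The induction
  appends one cell on the right.\<close>

lemma uniform_tagged_division_exists:
  fixes a h :: real
  assumes "h \<ge> 0"
  shows "\<exists>p. p tagged_division_of {a..a + real (Suc n) * h} \<and>
    (\<forall>(t, K)\<in>p. (\<exists>j. t = a + real j * h) \<and> measure lborel K = h)"
proof (induction n)
  case 0
  have "{(a, {a..a + h})} tagged_division_of {a..a + h}"
    using assms by (intro tagged_division_of_self_real) auto
  then show ?case
    using assms by (intro exI[of _ "{(a, {a..a + h})}"]) (auto intro: exI[of _ 0])
next
  case (Suc n)
  define c where "c = a + real (Suc n) * h"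
  obtain p where p: "p tagged_division_of {a..c}"
    "\<forall>(t, K)\<in>p. (\<exists>j. t = a + real j * h) \<and> measure lborel K = h"
    using Suc unfolding c_def by blast
  have "{(c, {c..c + h})} tagged_division_of {c..c + h}"
    using assms by (intro tagged_division_of_self_real) auto
  then have "(p \<union> {(c, {c..c + h})}) tagged_division_of ({a..c} \<union> {c..c + h})"
    by (intro tagged_division_Un p) auto
  also have "{a..c} \<union> {c..c + h} = {a..a + real (Suc (Suc n)) * h}"
  proof -
    have "a \<le> c" "c + h = a + real (Suc (Suc n)) * h"
      using assms by (simp_all add: c_def algebra_simps)
    then show ?thesis
      using assms by auto
  qed
  finally have q: "(p \<union> {(c, {c..c + h})}) tagged_division_of {a..a + real (Suc (Suc n)) * h}" .
  have "measure lborel {c..c + h} = h"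
    using assms by simp
  moreover have "\<exists>j. c = a + real j * h"
    using c_def by blast
  ultimately have "\<forall>(t, K)\<in>p \<union> {(c, {c..c + h})}.
      (\<exists>j. t = a + real j * h) \<and> measure lborel K = h"
    using p(2) by (simp only: ball_Un ball_simps prod.case)
  with q show ?case
    by (intro exI conjI)
qed

section \<open>Zeros and bounds of the product\<close>

lemma sin_prod_nonneg: "0 \<le> sin_prod x"
  by (rule LIMSEQ_le_const[OF sin_partial_prod_LIMSEQ]) (auto simp: sin_partial_prod_bounds)

lemma sin_prod_le_one: "sin_prod x \<le> 1"
  by (rule LIMSEQ_le_const2[OF sin_partial_prod_LIMSEQ]) (auto simp: sin_partial_prod_bounds)

lemma borel_measurable_sin_prod [measurable]: "sin_prod \<in> borel_measurable borel"
proof (rule borel_measurable_LIMSEQ_real[OF sin_partial_prod_LIMSEQ])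
  show "(\<lambda>x. sin_partial_prod x k) \<in> borel_measurable borel" for k
    unfolding sin_partial_prod_def by measurable
qed

text \<open>The factor with index \<open>m\<close> is a power of \<open>sin (j * pi)\<close>, so all
  partial products from \<open>m\<close> on vanish.\<close>

lemma sin_prod_dyadic_pi: "sin_prod (real j * (pi / 2 ^ m)) = 0"
proof -
  have "sin (2 ^ m * (real j * (pi / 2 ^ m))) = 0"
    using sin_npi[of j] by (simp add: field_simps)
  then have "sin_partial_prod (real j * (pi / 2 ^ m)) k = 0" if "k \<ge> m" for k
    unfolding sin_partial_prod_def using that by (intro prod_zero bexI[of _ m]) auto
  then have "\<forall>\<^sub>F k in sequentially. sin_partial_prod (real j * (pi / 2 ^ m)) k = 0"
    by (auto simp: eventually_sequentially)
  then have "sin_partial_prod (real j * (pi / 2 ^ m)) \<longlonglongrightarrow> 0"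
    by (rule tendsto_eventually)
  with sin_partial_prod_LIMSEQ show ?thesis
    by (rule LIMSEQ_unique)
qed

section \<open>A set of positive measure on which the product is bounded below\<close>

text \<open>Jordan's inequality: by concavity on \<open>{0..pi / 2}\<close>, sine lies above its
  chord from 0 to \<open>pi / 2\<close>.\<close>

lemma abs_sin_ge_linear:
  fixes u :: real
  assumes "\<bar>u\<bar> \<le> pi / 2"
  shows "2 / pi * \<bar>u\<bar> \<le> \<bar>sin u\<bar>"
proof -
  have "concave_on {0..pi / 2} (sin :: real \<Rightarrow> real)"
  proof (rule f''_le0_imp_concave)
    show "(sin has_real_derivative cos x) (at x)" for x :: real
      by (rule DERIV_sin)
    show "(cos has_real_derivative - sin x) (at x)" for x :: real
      by (rule DERIV_cos)
    show "- sin x \<le> 0" if "x \<in> {0..pi / 2}" for x :: real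
      using that sin_ge_zero[of x] by auto
  qed auto
  moreover define s where "s = 2 / pi * \<bar>u\<bar>"
  moreover have "0 \<le> s" "s \<le> 1"
    using assms by (auto simp: s_def field_simps)
  ultimately have "(1 - s) * sin 0 + s * sin (pi / 2) \<le> sin ((1 - s) *\<^sub>R 0 + s *\<^sub>R (pi / 2))"
    by (intro concave_onD) auto
  then have "s \<le> sin \<bar>u\<bar>"
    by (simp add: s_def)
  also have "\<dots> \<le> \<bar>sin u\<bar>"
    by (simp add: abs_if)
  finally show ?thesis
    by (simp add: s_def)
qed

text \<open>Subtracting the nearest multiple of \<open>pi\<close> leaves
  \<open>\<bar>sin y\<bar>\<close> unchanged and reduces to Jordan's inequality.\<close>

lemma abs_sin_near_multiple_of_pi:
  fixes y :: real
  shows "2 / pi * \<bar>y - real_of_int (round (y / pi)) * pi\<bar> \<le> \<bar>sin y\<bar>"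
proof -
  define k where "k = round (y / pi)"
  have "\<bar>y / pi - real_of_int k\<bar> \<le> 1 / 2"
    using of_int_round_abs_le[of "y / pi"] by (simp add: k_def abs_minus_commute)
  then have "\<bar>y / pi - real_of_int k\<bar> * pi \<le> 1 / 2 * pi"
    by (intro mult_right_mono) auto
  also have "\<bar>y / pi - real_of_int k\<bar> * pi = \<bar>(y / pi - real_of_int k) * pi\<bar>"
    by (simp add: abs_mult)
  finally have "\<bar>y - real_of_int k * pi\<bar> \<le> pi / 2"
    by (simp add: left_diff_distrib)
  then have "2 / pi * \<bar>y - real_of_int k * pi\<bar> \<le> \<bar>sin (y - real_of_int k * pi)\<bar>"
    by (rule abs_sin_ge_linear)
  also have "\<bar>sin (y - real_of_int k * pi)\<bar> = \<bar>sin y\<bar>"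
    by (simp add: sin_diff abs_mult mult.commute[of _ pi])
  finally show ?thesis
    by (simp add: k_def)
qed

text \<open>A small sine forces \<open>2 ^ n * x\<close> to within
  \<open>pi * \<epsilon> / 2\<close> of a multiple of \<open>pi\<close>. Thus \<open>x\<close> lies
  in one of \<open>2 ^ n + 1\<close> intervals of length
  \<open>pi * \<epsilon> / 2 ^ n\<close>.\<close>

lemma measure_abs_sin_less:
  fixes \<epsilon> :: real
  assumes "\<epsilon> \<ge> 0"
  shows "measure lebesgue {x \<in> {0..pi}. \<bar>sin (2 ^ n * x)\<bar> < \<epsilon>} \<le> 2 * pi * \<epsilon>"
proof -
  define J where "J j = {(real j * pi - pi * \<epsilon> / 2) / 2 ^ n..(real j * pi + pi * \<epsilon> / 2) / 2 ^ n}"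
    for j
  have "{x \<in> {0..pi}. \<bar>sin (2 ^ n * x)\<bar> < \<epsilon>} \<subseteq> (\<Union>j\<in>{..2 ^ n}. J j)"
  proof
    fix x
    assume x: "x \<in> {x \<in> {0..pi}. \<bar>sin (2 ^ n * x)\<bar> < \<epsilon>}"
    \<comment> \<open>Monotonicity of \<open>round\<close> confines \<open>k\<close> to
      \<open>0..2 ^ n\<close>, so finitely many intervals suffice.\<close>
    define k where "k = round (2 ^ n * x / pi)"
    have "k \<ge> 0"
      using x round_mono[of 0 "2 ^ n * x / pi"] by (simp add: k_def)
    moreover have "k \<le> 2 ^ n"
      using x round_mono[of "2 ^ n * x / pi" "of_int (2 ^ n)"] unfolding k_def round_of_int
      by (simp add: field_simps)
    ultimately have k: "real (nat k) = real_of_int k" "nat k \<le> 2 ^ n"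
      by (auto simp: nat_le_iff)
    have "2 / pi * \<bar>2 ^ n * x - real_of_int k * pi\<bar> < \<epsilon>"
      using abs_sin_near_multiple_of_pi[of "2 ^ n * x"] x by (simp add: k_def)
    then have "\<bar>2 ^ n * x - real_of_int k * pi\<bar> < pi * \<epsilon> / 2"
      by (simp add: field_simps)
    then have "real_of_int k * pi - pi * \<epsilon> / 2 \<le> 2 ^ n * x"
      "2 ^ n * x \<le> real_of_int k * pi + pi * \<epsilon> / 2"
      by linarith+
    then have "x \<in> J (nat k)"
      unfolding J_def k(1)
      by (simp add: pos_divide_le_eq pos_le_divide_eq mult.commute[of x "2 ^ n"])
    with k(2) show "x \<in> (\<Union>j\<in>{..2 ^ n}. J j)"
      by blast
  qed
  then have "measure lebesgue {x \<in> {0..pi}. \<bar>sin (2 ^ n * x)\<bar> < \<epsilon>} \<le>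
      measure lebesgue (\<Union>j\<in>{..2 ^ n}. J j)"
    by (intro measure_mono_fmeasurable) (auto simp: J_def intro!: fmeasurable.finite_UN)
  also have "\<dots> \<le> (\<Sum>j\<in>{..2 ^ n}. measure lebesgue (J j))"
    by (rule measure_UNION_le) (auto simp: J_def)
  also have "\<dots> = (\<Sum>j\<in>{..(2::nat) ^ n}. pi * \<epsilon> / 2 ^ n)"
  proof (rule sum.cong)
    fix j
    have "(real j * pi + pi * \<epsilon> / 2) / 2 ^ n - (real j * pi - pi * \<epsilon> / 2) / 2 ^ n = pi * \<epsilon> / 2 ^ n"
      by (simp add: diff_divide_distrib[symmetric])
    moreover have "(real j * pi - pi * \<epsilon> / 2) / 2 ^ n \<le> (real j * pi + pi * \<epsilon> / 2) / 2 ^ n"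
      using assms by (intro divide_right_mono) auto
    ultimately show "measure lebesgue (J j) = pi * \<epsilon> / 2 ^ n"
      by (simp add: J_def)
  qed auto
  also have "\<dots> = (2 ^ n + 1) * (pi * \<epsilon> / 2 ^ n)"
    by (simp add: algebra_simps)
  \<comment> \<open>Estimating \<open>2 ^ n + 1\<close> by \<open>2 * 2 ^ n\<close> makes the bound
    independent of \<open>n\<close>.\<close>
  also have "\<dots> \<le> (2 * 2 ^ n) * (pi * \<epsilon> / 2 ^ n)"
    using assms by (intro mult_right_mono) auto
  finally show ?thesis
    by simp
qed

text \<open>Equal to \<open>1 / (4 * (n + 1)) - 1 / (4 * (n + 2))\<close>, so its sums
  telescope.\<close>

definition threshold :: "nat \<Rightarrow> real" where
  "threshold n = 1 / (4 * (real n + 1) * (real n + 2))"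

lemma threshold_pos: "threshold n > 0"
  by (simp add: threshold_def)

lemma sum_threshold_le: "sum threshold {..n} \<le> 1 / 4"
proof -
  have "sum threshold {..n} = 1 / 4 - 1 / (4 * (real n + 2))"
  proof (induction n)
    case 0
    then show ?case
      by (simp add: threshold_def)
  next
    case (Suc n)
    have "1 / (4 * (real n + 2)) - threshold (Suc n) = 1 / (4 * (real (Suc n) + 2))"
      unfolding threshold_def by (simp add: divide_simps) (simp add: algebra_simps)
    with Suc show ?case
      by simp
  qed
  then show ?thesis
    by simp
qed

definition good_set :: "real set" where
  "good_set = {x \<in> {0..pi}. \<forall>n. threshold n \<le> \<bar>sin (2 ^ n * x)\<bar>}"

lemma good_set_lmeasurable: "good_set \<in> lmeasurable"
  and measure_good_set: "measure lebesgue good_set \<ge> pi / 2"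
proof -
  define B where "B n = {x \<in> {0..pi}. \<bar>sin (2 ^ n * x)\<bar> < threshold n}" for n :: nat
  have sets_B: "B n \<in> sets borel" for n
    unfolding B_def by measurable
  have B: "B n \<in> lmeasurable" for n
    by (rule fmeasurableI2[of "{0..pi}"]) (use sets_B[of n] in \<open>auto simp: B_def\<close>)
  \<comment> \<open>A bound on the finite unions that is uniform in \<open>n\<close> carries over to
    the countable union.\<close>
  have *: "measure lebesgue (\<Union>i\<le>n. B i) \<le> pi / 2" for n
  proof -
    have "measure lebesgue (\<Union>i\<le>n. B i) \<le> (\<Sum>i\<le>n. measure lebesgue (B i))"
      using B by (intro measure_UNION_le) auto
    also have "\<dots> \<le> (\<Sum>i\<le>n. 2 * pi * threshold i)"
      unfolding B_def by (intro sum_mono measure_abs_sin_less less_imp_le threshold_pos)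
    also have "\<dots> = 2 * pi * sum threshold {..n}"
      by (simp add: sum_distrib_left)
    also have "\<dots> \<le> 2 * pi * (1 / 4)"
      by (intro mult_left_mono sum_threshold_le) auto
    finally show ?thesis
      by simp
  qed
  have U: "(\<Union>n. B n) \<in> lmeasurable" "measure lebesgue (\<Union>n. B n) \<le> pi / 2"
    using fmeasurable_countable_Union[OF B *] measure_countable_Union_le[OF B *] by auto
  have eq: "good_set = {0..pi} - (\<Union>n. B n)"
    unfolding good_set_def B_def by (auto simp: not_less) (meson not_less)
  show "good_set \<in> lmeasurable"
    unfolding eq using U(1) by (intro fmeasurable.Diff) auto
  show "measure lebesgue good_set \<ge> pi / 2"
    using measure_diff_le_measure_setdiff[of "{0..pi}" lebesgue "\<Union>n. B n"] U eq by simp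
qed

text \<open>The terms are of order \<open>ln n / n ^ 2\<close>; any comparison exponent strictly
  between -2 and -1 would absorb the logarithm.\<close>

lemma summable_log_threshold:
  "summable (\<lambda>n. 2 / (2 * real n + 1)\<^sup>2 * - ln (threshold n))"
proof (rule summable_comparison_test_bigo)
  show "summable (\<lambda>n. norm (real n powr (- 3 / 2)))"
    by (simp add: summable_real_powr_iff)
  show "(\<lambda>n. 2 / (2 * real n + 1)\<^sup>2 * - ln (threshold n)) \<in> O(\<lambda>n. real n powr (- 3 / 2))"
    unfolding threshold_def by real_asymp
qed

lemma sin_prod_bounded_below_on_good_set:
  obtains c where "c > 0" "\<And>x. x \<in> good_set \<Longrightarrow> c \<le> sin_prod x"
proof -
  define w where "w n = 2 / (2 * real n + 1)\<^sup>2" for n :: nat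
  define S where "S = (\<Sum>n. w n * - ln (threshold n))"
  have "exp (- S) \<le> sin_prod x" if x: "x \<in> good_set" for x
  proof (rule LIMSEQ_le_const[OF sin_partial_prod_LIMSEQ], intro exI allI impI)
    fix k
    \<comment> \<open>This makes the terms of the series nonnegative, so its partial sums stay below
      \<open>S\<close> and \<open>exp (- S)\<close> serves for all \<open>k\<close> and
      \<open>x\<close> at once.\<close>
    have "threshold n \<le> 1" for n
      unfolding threshold_def by (simp add: divide_simps algebra_simps)
    then have "0 \<le> w n * - ln (threshold n)" for n
      using threshold_pos[of n] by (intro mult_nonneg_nonneg) (auto simp: w_def)
    then have "(\<Sum>n\<le>k. w n * - ln (threshold n)) \<le> S"
      unfolding S_def using summable_log_threshold
      by (intro sum_le_suminf) (auto simp: w_def)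
    then have "exp (- S) \<le> exp (\<Sum>n\<le>k. w n * ln (threshold n))"
      by (simp add: sum_negf)
    also have "\<dots> = (\<Prod>n\<le>k. threshold n powr w n)"
      using threshold_pos by (simp add: exp_sum powr_def less_imp_neq[symmetric])
    also have "\<dots> \<le> sin_partial_prod x k"
      unfolding sin_partial_prod_def w_def[symmetric]
      using x threshold_pos
      by (intro prod_mono conjI powr_mono2) (auto simp: good_set_def w_def less_imp_le)
    finally show "exp (- S) \<le> sin_partial_prod x k" .
  qed
  then show ?thesis
    by (intro that[of "exp (- S)"]) auto
qed

section \<open>Integrability\<close>

text \<open>The product dominates \<open>c\<close> times the indicator of \<open>good_set\<close>, a
  set of measure at least \<open>pi / 2\<close>.\<close>

lemma has_integral_sin_prod_pos:
  assumes "(sin_prod has_integral I) {0..pi}"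
  shows "I > 0"
proof -
  obtain c where c: "c > 0" "\<And>x. x \<in> good_set \<Longrightarrow> c \<le> sin_prod x"
    using sin_prod_bounded_below_on_good_set by blast
  have "((\<lambda>x. 1) has_integral measure lebesgue good_set) good_set"
    using good_set_lmeasurable by (simp add: has_integral_iff lmeasure_integral lmeasurable_iff_integrable_on)
  then have "((\<lambda>x. c * 1) has_integral c * measure lebesgue good_set) good_set"
    by (rule has_integral_mult_right)
  moreover have "good_set \<subseteq> {0..pi}"
    by (auto simp: good_set_def)
  ultimately have "((\<lambda>x. if x \<in> good_set then c * 1 else 0) has_integral
      c * measure lebesgue good_set) {0..pi}"
    by (simp only: has_integral_restrict)
  then have "c * measure lebesgue good_set \<le> I"
    using assms by (rule has_integral_le) (simp add: c(2) sin_prod_nonneg)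
  moreover have "c * measure lebesgue good_set > 0"
    using c(1) measure_good_set pi_gt_zero by (intro mult_pos_pos) linarith+
  ultimately show ?thesis
    by linarith
qed

lemma not_riemann_integrable_sin_prod: "\<not> riemann_integrable sin_prod 0 pi"
proof
  assume "riemann_integrable sin_prod 0 pi"
  then obtain I where I: "\<And>\<epsilon>. \<epsilon> > 0 \<Longrightarrow> \<exists>\<delta>>0. \<forall>p. p tagged_division_of {0..pi} \<and>
      (\<forall>(t, K)\<in>p. measure lborel K < \<delta>) \<longrightarrow>
      \<bar>(\<Sum>(t, K)\<in>p. measure lborel K * sin_prod t) - I\<bar> < \<epsilon>"
    unfolding riemann_integrable_def by blast
  have "I > 0"
    using I by (intro has_integral_sin_prod_pos riemann_integrable_imp_has_integral)
  \<comment> \<open>The tolerance is \<open>I\<close> itself: a Riemann sum equal to 0 is at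
    distance exactly \<open>I\<close>, which violates the strict bound.\<close>
  with I obtain \<delta> where "\<delta> > 0" and \<delta>: "\<And>p. p tagged_division_of {0..pi} \<Longrightarrow>
      (\<forall>(t, K)\<in>p. measure lborel K < \<delta>) \<Longrightarrow>
      \<bar>(\<Sum>(t, K)\<in>p. measure lborel K * sin_prod t) - I\<bar> < I"
    by meson
  have "(\<lambda>m. pi / 2 ^ m) \<longlonglongrightarrow> 0"
    by real_asymp
  then have "\<forall>\<^sub>F m in sequentially. pi / 2 ^ m < \<delta>"
    using \<open>\<delta> > 0\<close> by (rule order_tendstoD)
  then obtain m where m: "pi / 2 ^ m < \<delta>"
    by (auto simp: eventually_sequentially)
  \<comment> \<open>The division lemma counts \<open>Suc n\<close> cells, hence
    \<open>n = 2 ^ m - 1\<close> for \<open>2 ^ m\<close> cells.\<close>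
  have "real (Suc (2 ^ m - 1)) * (pi / 2 ^ m) = pi"
    by simp
  then obtain p where p: "p tagged_division_of {0..pi}"
    "\<forall>(t, K)\<in>p. (\<exists>j. t = real j * (pi / 2 ^ m)) \<and> measure lborel K = pi / 2 ^ m"
    using uniform_tagged_division_exists[of "pi / 2 ^ m" 0 "2 ^ m - 1"] by auto
  have "(\<Sum>(t, K)\<in>p. measure lborel K * sin_prod t) = 0"
    using p(2) by (intro sum.neutral) (auto simp del: times_divide_eq_right simp: sin_prod_dyadic_pi)
  with \<delta>[OF p(1)] p(2) m \<open>I > 0\<close> show False
    by fastforce
qed

theorem mainTheorem1:
  "range sin_prod \<subseteq> {0..1} \<and>
   set_integrable lebesgue {0..pi} sin_prod \<and>
   \<not> riemann_integrable sin_prod 0 pi"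
proof (intro conjI)
  show "range sin_prod \<subseteq> {0..1}"
    by (auto simp: sin_prod_nonneg sin_prod_le_one)
  show "set_integrable lebesgue {0..pi} sin_prod"
    unfolding set_integrable_def
  proof (rule integrableI_bounded_set_indicator[where B = 1])
    show "sin_prod \<in> borel_measurable lebesgue"
      by (intro measurable_completion) simp
  qed (auto simp: sin_prod_nonneg sin_prod_le_one)
  show "\<not> riemann_integrable sin_prod 0 pi"
    by (rule not_riemann_integrable_sin_prod)
qed

end
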